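(* Let $R$ be a finite valuation ring of order $q^r$. Let $Q$ be a set of points in $R^3$ and $\Pi$ a set of planes in $R^3$. Then the number of incidences $|I(Q,\Pi)|$ between $Q$ and $\Pi$ satisfies $$\left||I(Q,\Pi)|-\frac{1}{q^{r-1}}\,\frac{q^{2}+q+1}{q^3+q^2+q+1}\,|Q||\Pi|\right|\le q^{2r-1}|Q|^{\frac{1}{2}}|\Pi|^{\frac{1}{2}}.$$ Hence $$|I(Q,\Pi)|\le \frac{1}{q^r}|Q||\Pi|+ q^{2r-1}|Q|^{\frac{1}{2}}|\Pi|^{\frac{1}{2}}.$$
   Context: A finite valuation ring is a finite commutative ring with identity that is local and principal (every ideal is principal). Saying that $R$ is a finite valuation ring of order $q^r$ means that the residue field of $R$ (the quotient by its maximal ideal) has $q$ elements, that $r\ge 1$ is the nilpotency index of the maximal ideal (the least $r$ such that its $r$-th power is zero), and hence $|R|=q^r$. Let $R^{*}$ be the set of units and $R^{0}$ the set of nonunits of $R$. A plane in $R^3$ is given by an equation $ax+by+cz=d$ with $(a,b,c,d)\in R^4\setminus (R^{0})^4$, where two equations whose coefficient vectors $(a,b,c,d)$ differ by multiplication by an element of $R^{*}$ are identified. A point $(x_1,x_2,x_3)\in R^3$ is incident to this plane if $ax_1+bx_2+cx_3=d$. The set of incidences is $I(Q,\Pi)=\{(p,\pi)\in Q\times\Pi: p \text{ is incident to } \pi\}$. *)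

theory Defs
  imports Complex_Main "HOL-Algebra.Ideal_Product" "HOL-Algebra.QuotRing"
begin

definition finite_valuation_ring :: "('a, 'm) ring_scheme \<Rightarrow> bool" where
  "finite_valuation_ring R \<longleftrightarrow>
     cring R \<and> finite (carrier R) \<and> (\<exists>!M. maximalideal M R) \<and>
     (\<forall>I. ideal I R \<longrightarrow> principalideal I R)"

definition max_ideal :: "('a, 'm) ring_scheme \<Rightarrow> 'a set" where
  "max_ideal R = (THE M. maximalideal M R)"

(* Powers of ideals are powers in the monoid ideals_set R of ideals under the
   ideal product, so the zeroth power of an ideal is carrier R. *)
definition nilpotency_index :: "('a, 'm) ring_scheme \<Rightarrow> 'a set \<Rightarrow> nat \<Rightarrow> bool" where
  "nilpotency_index R I r \<longleftrightarrow>
     I [^]\<^bsub>ideals_set R\<^esub> r = {\<zero>\<^bsub>R\<^esub>} \<and>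
     (\<forall>s<r. I [^]\<^bsub>ideals_set R\<^esub> s \<noteq> {\<zero>\<^bsub>R\<^esub>})"

(* The pair (q, r) determines more than the number q ^ r: q is the size of the
   residue field and r the nilpotency index. That the ring has q ^ r elements
   is a consequence and not part of the definition. *)
definition finite_valuation_ring_of_order ::
    "('a, 'm) ring_scheme \<Rightarrow> nat \<Rightarrow> nat \<Rightarrow> bool" where
  "finite_valuation_ring_of_order R q r \<longleftrightarrow>
     finite_valuation_ring R \<and>
     card (carrier (R Quot max_ideal R)) = q \<and>
     r \<ge> 1 \<and> nilpotency_index R (max_ideal R) r"

definition nonunits :: "('a, 'm) ring_scheme \<Rightarrow> 'a set" where
  "nonunits R = carrier R - Units R"

definition points :: "('a, 'm) ring_scheme \<Rightarrow> ('a \<times> 'a \<times> 'a) set" where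
  "points R = carrier R \<times> carrier R \<times> carrier R"

definition plane_coeffs :: "('a, 'm) ring_scheme \<Rightarrow> ('a \<times> 'a \<times> 'a \<times> 'a) set" where
  "plane_coeffs R =
     (carrier R \<times> carrier R \<times> carrier R \<times> carrier R) -
     (nonunits R \<times> nonunits R \<times> nonunits R \<times> nonunits R)"

definition unit_proportional ::
    "('a, 'm) ring_scheme \<Rightarrow> (('a \<times> 'a \<times> 'a \<times> 'a) \<times> ('a \<times> 'a \<times> 'a \<times> 'a)) set" where
  "unit_proportional R =
     {((a, b, c, d), (a', b', c', d')) | a b c d a' b' c' d'.
        (a, b, c, d) \<in> plane_coeffs R \<and> (a', b', c', d') \<in> plane_coeffs R \<and>
        (\<exists>u \<in> Units R. a' = u \<otimes>\<^bsub>R\<^esub> a \<and> b' = u \<otimes>\<^bsub>R\<^esub> b \<and>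
                        c' = u \<otimes>\<^bsub>R\<^esub> c \<and> d' = u \<otimes>\<^bsub>R\<^esub> d)}"

(* A plane is a class of equations a x + b y + c z = d, not its solution set:
   distinct planes may have the same solutions (for instance none at all, when
   a, b, c are nonunits and d is a unit). *)
definition planes :: "('a, 'm) ring_scheme \<Rightarrow> ('a \<times> 'a \<times> 'a \<times> 'a) set set" where
  "planes R = plane_coeffs R // unit_proportional R"

fun satisfies :: "('a, 'm) ring_scheme \<Rightarrow> 'a \<times> 'a \<times> 'a \<Rightarrow> 'a \<times> 'a \<times> 'a \<times> 'a \<Rightarrow> bool" where
  "satisfies R (x, y, z) (a, b, c, d) \<longleftrightarrow>
     a \<otimes>\<^bsub>R\<^esub> x \<oplus>\<^bsub>R\<^esub> b \<otimes>\<^bsub>R\<^esub> y \<oplus>\<^bsub>R\<^esub> c \<otimes>\<^bsub>R\<^esub> z = d"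

(* Independent of the representative, by incident_iff_satisfies below. *)
definition incident ::
    "('a, 'm) ring_scheme \<Rightarrow> 'a \<times> 'a \<times> 'a \<Rightarrow> ('a \<times> 'a \<times> 'a \<times> 'a) set \<Rightarrow> bool" where
  "incident R p \<pi> \<longleftrightarrow> (\<exists>v \<in> \<pi>. satisfies R p v)"

definition incidences ::
    "('a, 'm) ring_scheme \<Rightarrow> ('a \<times> 'a \<times> 'a) set \<Rightarrow> ('a \<times> 'a \<times> 'a \<times> 'a) set set \<Rightarrow>
     (('a \<times> 'a \<times> 'a) \<times> ('a \<times> 'a \<times> 'a \<times> 'a) set) set" where
  "incidences R Q P = {(p, \<pi>) \<in> Q \<times> P. incident R p \<pi>}"

lemma equiv_unit_proportional:
  assumes "cring R"
  shows "equiv (plane_coeffs R) (unit_proportional R)"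
proof -
  interpret cring R by fact
  show ?thesis
  proof (rule equivI)
    show "unit_proportional R \<subseteq> plane_coeffs R \<times> plane_coeffs R"
      by (auto simp: unit_proportional_def)
    show "refl_on (plane_coeffs R) (unit_proportional R)"
    proof (rule refl_onI)
      fix v assume "v \<in> plane_coeffs R"
      then show "(v, v) \<in> unit_proportional R"
        by (cases v) (auto simp: unit_proportional_def plane_coeffs_def intro!: bexI[of _ "\<one>\<^bsub>R\<^esub>"])
    qed
    show "sym (unit_proportional R)"
    proof (rule symI)
      fix v w assume "(v, w) \<in> unit_proportional R"
      then obtain a b c d u where v: "v = (a, b, c, d)" and u: "u \<in> Units R"
        and w: "w = (u \<otimes>\<^bsub>R\<^esub> a, u \<otimes>\<^bsub>R\<^esub> b, u \<otimes>\<^bsub>R\<^esub> c, u \<otimes>\<^bsub>R\<^esub> d)"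
        and vw: "v \<in> plane_coeffs R" "w \<in> plane_coeffs R"
        by (auto simp: unit_proportional_def)
      have inv: "inv\<^bsub>R\<^esub> u \<otimes>\<^bsub>R\<^esub> (u \<otimes>\<^bsub>R\<^esub> x) = x" if "x \<in> carrier R" for x
        using that u by (metis Units_closed Units_inv_closed Units_l_inv l_one m_assoc)
      show "(w, v) \<in> unit_proportional R"
        using vw inv Units_inv_Units[OF u] unfolding v w unit_proportional_def plane_coeffs_def
        by (simp, metis)
    qed
    show "trans (unit_proportional R)"
    proof (rule transI)
      fix v w x assume "(v, w) \<in> unit_proportional R" "(w, x) \<in> unit_proportional R"
      then obtain a b c d u t where v: "v = (a, b, c, d)" and u: "u \<in> Units R" "t \<in> Units R"
        and x: "x = (t \<otimes>\<^bsub>R\<^esub> (u \<otimes>\<^bsub>R\<^esub> a), t \<otimes>\<^bsub>R\<^esub> (u \<otimes>\<^bsub>R\<^esub> b), t \<otimes>\<^bsub>R\<^esub> (u \<otimes>\<^bsub>R\<^esub> c), t \<otimes>\<^bsub>R\<^esub> (u \<otimes>\<^bsub>R\<^esub> d))"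
        and vx: "v \<in> plane_coeffs R" "x \<in> plane_coeffs R"
        by (auto simp: unit_proportional_def)
      have "t \<otimes>\<^bsub>R\<^esub> (u \<otimes>\<^bsub>R\<^esub> y) = (t \<otimes>\<^bsub>R\<^esub> u) \<otimes>\<^bsub>R\<^esub> y" if "y \<in> carrier R" for y
        using that u by (simp add: m_assoc Units_closed)
      then show "(v, x) \<in> unit_proportional R"
        using vx Units_m_closed[OF u(2) u(1)] unfolding v x unit_proportional_def plane_coeffs_def
        by (simp, metis)
    qed
  qed
qed

lemma incident_iff_satisfies:
  assumes "cring R" "\<pi> \<in> planes R" "v \<in> \<pi>" "p \<in> points R"
  shows "incident R p \<pi> \<longleftrightarrow> satisfies R p v"
proof -
  interpret cring R by fact
  have "satisfies R p v" if "w \<in> \<pi>" "satisfies R p w" for w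
  proof -
    have "(w, v) \<in> unit_proportional R"
      using assms that equiv_unit_proportional[OF assms(1)]
      unfolding planes_def by (meson quotient_eq_iff)
    then obtain a b c d u where w: "w = (a, b, c, d)" and u: "u \<in> Units R"
      and v: "v = (u \<otimes>\<^bsub>R\<^esub> a, u \<otimes>\<^bsub>R\<^esub> b, u \<otimes>\<^bsub>R\<^esub> c, u \<otimes>\<^bsub>R\<^esub> d)"
      and carr: "a \<in> carrier R" "b \<in> carrier R" "c \<in> carrier R" "d \<in> carrier R"
      by (auto simp: unit_proportional_def plane_coeffs_def)
    obtain x y z where p: "p = (x, y, z)"
      and xyz: "x \<in> carrier R" "y \<in> carrier R" "z \<in> carrier R"
      using assms(4) by (auto simp: points_def)
    have "u \<otimes>\<^bsub>R\<^esub> a \<otimes>\<^bsub>R\<^esub> x \<oplus>\<^bsub>R\<^esub> u \<otimes>\<^bsub>R\<^esub> b \<otimes>\<^bsub>R\<^esub> y \<oplus>\<^bsub>R\<^esub> u \<otimes>\<^bsub>R\<^esub> c \<otimes>\<^bsub>R\<^esub> z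
      = u \<otimes>\<^bsub>R\<^esub> (a \<otimes>\<^bsub>R\<^esub> x \<oplus>\<^bsub>R\<^esub> b \<otimes>\<^bsub>R\<^esub> y \<oplus>\<^bsub>R\<^esub> c \<otimes>\<^bsub>R\<^esub> z)"
      using Units_closed[OF u] carr xyz by (simp add: m_assoc r_distr)
    then show ?thesis
      using that(2) unfolding v w p by simp
  qed
  then show ?thesis using assms(3) unfolding incident_def by blast
qed

end

(* Second moment method over coefficient vectors instead of planes: every plane consists of
   |R*| vectors. Write n = |R| and m = |R^0|. Through every point pass n^3 - m^3 vectors, and
   every plane with a, b or c a unit has n^2 points. A difference of two points is a multiple
   of a vector with a unit coordinate (Nakayama), so at least n^2 - m^2 vectors pass through
   both points. The surplus over this lower bound is nonnegative, hence its sum over the second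
   point in Q is at most its sum over all of R^3, which is m^2 n^2 (n - m). As
   (n^2 - m^2) (n^4 - m^4) <= (n^3 - m^3)^2, the variance of the number of points of Q on a
   plane is controlled, and Cauchy-Schwarz over the planes in P gives the bound with the
   constant m n = q^(2r-1). *)

theory Submission
  imports Defs "HOL-Analysis.L2_Norm"
begin

section \<open>Second moment of the degrees in a finite incidence relation\<close>

lemma real_card_filter:
  assumes "finite A"
  shows "real (card {x \<in> A. P x}) = (\<Sum>x\<in>A. of_bool (P x))"
  using assms by (simp add: Int_def)

text \<open>Expand the square. Interchanging sums, the squared degrees add up to the number of
  common neighbours over ordered pairs from \<open>Q\<close>, and the degrees add up to
  \<open>k\<close> times \<open>card Q\<close>. The subtracted constant is thus the mean degree, so
  the linear and the constant term merge into a single negative one.\<close>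

lemma sum_degree_deviation:
  fixes I :: "'p \<Rightarrow> 'v \<Rightarrow> bool"
  assumes "finite Q" "finite V"
    and deg: "\<And>p. p \<in> Q \<Longrightarrow> real (card {v \<in> V. I p v}) = k"
  shows "(\<Sum>v\<in>V. (real (card {p \<in> Q. I p v}) - k / real (card V) * real (card Q))\<^sup>2) =
    (\<Sum>p\<in>Q. \<Sum>p'\<in>Q. real (card {v \<in> V. I p v \<and> I p' v})) - k\<^sup>2 / real (card V) * (real (card Q))\<^sup>2"
proof -
  define f where "f v = real (card {p \<in> Q. I p v})" for v
  define c where "c = k / real (card V) * real (card Q)"
  have f: "f v = (\<Sum>p\<in>Q. of_bool (I p v))" for v
    unfolding f_def by (rule real_card_filter[OF assms(1)])
  have "(\<Sum>v\<in>V. f v) = (\<Sum>p\<in>Q. \<Sum>v\<in>V. of_bool (I p v))"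
    unfolding f by (rule sum.swap)
  also have "\<dots> = (\<Sum>p\<in>Q. k)"
    using deg by (intro sum.cong refl) (simp add: real_card_filter[OF assms(2)])
  finally have f1: "(\<Sum>v\<in>V. f v) = real (card Q) * k" by simp
  have "(\<Sum>v\<in>V. (f v)\<^sup>2) = (\<Sum>v\<in>V. \<Sum>p\<in>Q. \<Sum>p'\<in>Q. of_bool (I p v \<and> I p' v))"
    unfolding f power2_eq_square sum_product by (simp add: of_bool_conj)
  also have "\<dots> = (\<Sum>p\<in>Q. \<Sum>v\<in>V. \<Sum>p'\<in>Q. of_bool (I p v \<and> I p' v))"
    by (rule sum.swap)
  also have "\<dots> = (\<Sum>p\<in>Q. \<Sum>p'\<in>Q. \<Sum>v\<in>V. of_bool (I p v \<and> I p' v))"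
    by (intro sum.cong refl sum.swap)
  also have "\<dots> = (\<Sum>p\<in>Q. \<Sum>p'\<in>Q. real (card {v \<in> V. I p v \<and> I p' v}))"
    by (simp only: real_card_filter[OF assms(2)])
  finally have f2: "(\<Sum>v\<in>V. (f v)\<^sup>2) = (\<Sum>p\<in>Q. \<Sum>p'\<in>Q. real (card {v \<in> V. I p v \<and> I p' v}))" .
  have "(\<Sum>v\<in>V. (f v - c)\<^sup>2) = (\<Sum>v\<in>V. (f v)\<^sup>2 - 2 * c * f v + c\<^sup>2)"
    by (intro sum.cong refl) (simp add: power2_diff)
  also have "\<dots> = (\<Sum>v\<in>V. (f v)\<^sup>2) - 2 * c * (\<Sum>v\<in>V. f v) + real (card V) * c\<^sup>2"
    by (simp add: sum.distrib sum_subtractf sum_distrib_left)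
  also have "\<dots> = (\<Sum>v\<in>V. (f v)\<^sup>2) - k\<^sup>2 / real (card V) * (real (card Q))\<^sup>2"
    unfolding f1 c_def by (simp add: field_simps power2_eq_square)
  finally show ?thesis unfolding f2 by (simp add: f_def c_def)
qed

section \<open>Ideals in finite commutative rings\<close>

text \<open>First isomorphism theorem for the additive map of multiplication by \<open>g\<close> on
  \<open>J\<close>: every fibre is a translate of the kernel, so all fibres have the same
  size.\<close>

lemma (in cring) card_scale_image:
  assumes "finite (carrier R)" "additive_subgroup J R" "g \<in> carrier R"
  shows "card J = card {x \<in> J. g \<otimes> x = \<zero>} * card ((\<otimes>) g ` J)"
proof -
  interpret J: additive_subgroup J R by fact
  have fin: "finite J"
    using J.a_subset assms(1) finite_subset by blast
  have fibre: "card {x \<in> J. g \<otimes> x = y} = card {x \<in> J. g \<otimes> x = \<zero>}" if "y \<in> (\<otimes>) g ` J" for y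
  proof -
    obtain t where t: "t \<in> J" "y = g \<otimes> t" using \<open>y \<in> _\<close> by blast
    have tc: "t \<in> carrier R" and gt: "g \<otimes> t \<in> carrier R"
      using t J.a_Hcarr assms(3) by auto
    have "bij_betw (\<lambda>x. x \<oplus> t) {x \<in> J. g \<otimes> x = \<zero>} {x \<in> J. g \<otimes> x = y}"
    proof (rule bij_betw_byWitness[where f' = "\<lambda>x. x \<ominus> t"])
      show "\<forall>x\<in>{x \<in> J. g \<otimes> x = \<zero>}. x \<oplus> t \<ominus> t = x"
        using tc J.a_Hcarr by (auto simp: minus_eq a_assoc r_neg)
      show "\<forall>x\<in>{x \<in> J. g \<otimes> x = y}. x \<ominus> t \<oplus> t = x"
        using tc J.a_Hcarr by (auto simp: minus_eq a_assoc l_neg)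
      show "(\<lambda>x. x \<oplus> t) ` {x \<in> J. g \<otimes> x = \<zero>} \<subseteq> {x \<in> J. g \<otimes> x = y}"
        using tc t assms(3) J.a_Hcarr by (auto simp: r_distr)
      show "(\<lambda>x. x \<ominus> t) ` {x \<in> J. g \<otimes> x = y} \<subseteq> {x \<in> J. g \<otimes> x = \<zero>}"
        using tc gt t assms(3) J.a_Hcarr
        by (auto simp: minus_eq r_distr r_minus r_neg)
    qed
    then show ?thesis by (rule bij_betw_same_card[symmetric])
  qed
  have "card J = (\<Sum>y\<in>(\<otimes>) g ` J. card {x \<in> J. g \<otimes> x = y})"
    using sum.image_gen[OF fin, of "\<lambda>_. 1::nat" "(\<otimes>) g"] by simp
  also have "\<dots> = card {x \<in> J. g \<otimes> x = \<zero>} * card ((\<otimes>) g ` J)"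
    using fibre by simp
  finally show ?thesis .
qed

lemma (in ring) eq_zero_if_mult_Unit:
  assumes "u \<in> Units R" "g \<in> carrier R" "g \<otimes> u = \<zero>"
  shows "g = \<zero>"
proof -
  have "g = g \<otimes> u \<otimes> inv u"
    using assms(1,2) Units_closed by (simp add: m_assoc)
  then show ?thesis using assms by simp
qed

text \<open>The ideal product consists of finite sums of products. Here a single product
  \<open>(x \<otimes> g) \<otimes> j\<close> is \<open>g\<close> times an element of
  \<open>J\<close>, and such multiples are already closed under addition.\<close>

lemma (in cring) ideal_prod_cgenideal:
  assumes "g \<in> carrier R" "ideal J R"
  shows "ideal_prod R (PIdl g) J = (\<otimes>) g ` J"
proof
  interpret J: ideal J R by fact
  show "ideal_prod R (PIdl g) J \<subseteq> (\<otimes>) g ` J"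
  proof
    fix s assume "s \<in> ideal_prod R (PIdl g) J"
    then show "s \<in> (\<otimes>) g ` J"
    proof induction
      case (prod i j)
      then obtain x where x: "x \<in> carrier R" "i = x \<otimes> g" by (auto simp: cgenideal_def)
      have "i \<otimes> j = g \<otimes> (x \<otimes> j)"
        using x prod assms(1) J.Icarr by (simp add: m_ac)
      then show ?case using x prod J.I_l_closed by blast
    next
      case (sum s1 s2)
      then obtain x y where "x \<in> J" "y \<in> J" "s1 = g \<otimes> x" "s2 = g \<otimes> y" by blast
      then have "s1 \<oplus> s2 = g \<otimes> (x \<oplus> y)" "x \<oplus> y \<in> J"
        using assms(1) J.Icarr by (simp_all add: r_distr)
      then show ?case by blast
    qed
  qed
  show "(\<otimes>) g ` J \<subseteq> ideal_prod R (PIdl g) J"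
    using cgenideal_self[OF assms(1)] by (auto intro: ideal_prod.prod)
qed

text \<open>Finiteness replaces Zorn's lemma: there are only finitely many proper ideals above
  \<open>I\<close>, so one of them is maximal under inclusion.\<close>

lemma (in ring) exists_maximalideal:
  assumes "finite (carrier R)" "ideal I R" "I \<noteq> carrier R"
  shows "\<exists>M. maximalideal M R \<and> I \<subseteq> M"
proof -
  define A where "A = {J. ideal J R \<and> I \<subseteq> J \<and> J \<noteq> carrier R}"
  have sub: "J \<subseteq> carrier R" if "ideal J R" for J
    using that by (simp add: additive_subgroup.a_subset ideal.axioms(1))
  have "finite A"
    by (rule finite_subset[of _ "Pow (carrier R)"]) (use sub assms(1) in \<open>auto simp: A_def\<close>)
  moreover have "I \<in> A" using assms by (simp add: A_def)
  ultimately obtain M where M: "M \<in> A" "I \<subseteq> M" "\<And>J. J \<in> A \<Longrightarrow> M \<subseteq> J \<Longrightarrow> M = J"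
    using finite_has_maximal2[of A I] by meson
  have "maximalideal M R"
  proof (rule maximalidealI)
    fix J assume "ideal J R" "M \<subseteq> J" "J \<subseteq> carrier R"
    then show "J = M \<or> J = carrier R" using M(1,2) M(3)[of J] by (auto simp: A_def)
  qed (use M(1) in \<open>auto simp: A_def\<close>)
  then show ?thesis using M by blast
qed

text \<open>A nonunit generates a proper ideal, which lies in some maximal ideal and hence in the
  only one. Conversely, a unit in \<open>M\<close> would bring \<one> into \<open>M\<close>.\<close>

lemma (in cring) unique_maximalideal_eq_nonunits:
  assumes "finite (carrier R)" "\<exists>!M. maximalideal M R" "maximalideal M R"
  shows "M = nonunits R"
proof
  interpret M: maximalideal M R by fact
  show "M \<subseteq> nonunits R"
  proof
    fix x assume x: "x \<in> M"
    have "x \<notin> Units R"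
    proof
      assume u: "x \<in> Units R"
      then have "\<one> \<in> M"
        using M.I_l_closed[OF x Units_inv_closed[OF u]] Units_l_inv[OF u] by simp
      then show False using M.one_imp_carrier M.I_notcarr by simp
    qed
    then show "x \<in> nonunits R" using x M.Icarr by (simp add: nonunits_def)
  qed
  show "nonunits R \<subseteq> M"
  proof
    fix x assume "x \<in> nonunits R"
    then have x: "x \<in> carrier R" "x \<notin> Units R" by (simp_all add: nonunits_def)
    have "\<one> \<notin> PIdl x"
    proof
      assume "\<one> \<in> PIdl x"
      then obtain y where "y \<in> carrier R" "y \<otimes> x = \<one>" by (auto simp: cgenideal_def)
      then show False using x m_comm[OF x(1)] by (auto simp: Units_def)
    qed
    then have "PIdl x \<noteq> carrier R" by blast
    then obtain N where N: "maximalideal N R" "PIdl x \<subseteq> N"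
      using exists_maximalideal[OF assms(1) cgenideal_ideal[OF x(1)]] by blast
    have "N = M" using assms(2,3) N(1) by (elim ex1E) metis
    then show "x \<in> M" using N(2) cgenideal_self[OF x(1)] by blast
  qed
qed

section \<open>Cardinalities in finite local principal rings\<close>

text \<open>Locality is stated as the nonunits forming an ideal. This is the form in which the
  counting uses it, and it avoids the definite description in \<open>max_ideal\<close>.\<close>

locale finite_principal_local_ring = cring R for R (structure) +
  assumes finite_carrier: "finite (carrier R)"
    and nonunits_ideal: "ideal (nonunits R) R"
    and principal: "ideal I R \<Longrightarrow> principalideal I R"
begin

abbreviation M where "M \<equiv> nonunits R"

sublocale M: ideal M R by (rule nonunits_ideal)

lemma finite_M: "finite M"
  using finite_carrier by (simp add: nonunits_def)

lemma card_carrier_eq: "card (carrier R) = card M + card (Units R)"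
proof -
  have "M \<union> Units R = carrier R" "M \<inter> Units R = {}" "finite (Units R)"
    using Units_closed finite_carrier finite_subset[of "Units R" "carrier R"]
    by (auto simp: nonunits_def)
  then show ?thesis using card_Un_disjoint[OF finite_M, of "Units R"] by simp
qed

lemma card_M_pos: "0 < card M"
  using M.zero_closed finite_M by (metis card_gt_0_iff empty_iff)

lemma card_Units_pos: "0 < card (Units R)"
proof -
  have "finite (Units R)"
    using Units_closed finite_carrier finite_subset[of "Units R" "carrier R"] by blast
  then show ?thesis using Units_one_closed by (auto simp: card_gt_0_iff)
qed

lemma card_residue_field: "card (carrier (R Quot M)) * card M = card (carrier R)"
  using a_lagrange[OF finite_carrier M.additive_subgroup_axioms]
  by (simp add: FactRing_def order_def)

lemma ideal_eq_PIdl: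
  assumes "ideal I R"
  obtains g where "g \<in> carrier R" "I = PIdl g"
  using principalideal.generate[OF principal[OF assms]] cgenideal_eq_genideal by metis

text \<open>Let \<open>g\<close> generate \<open>I\<close>. As \<open>g\<close> is nonzero, no unit
  annihilates it, so multiplication by \<open>g\<close> has the same kernel K on the whole ring as
  on \<open>M\<close>. Hence |R| = |K| |I| and |M| = |K| |IM|, and the index of IM in I equals that
  of M in R.\<close>

lemma card_ideal_prod_M:
  assumes "ideal I R" "I \<noteq> {\<zero>}"
  shows "card I = card (carrier (R Quot M)) * card (ideal_prod R I M)"
proof -
  obtain g where g: "g \<in> carrier R" "I = PIdl g"
    using ideal_eq_PIdl[OF assms(1)] .
  have I: "I = (\<otimes>) g ` carrier R"
    using g m_comm by (auto simp: cgenideal_def)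
  have "g \<noteq> \<zero>"
  proof
    assume "g = \<zero>"
    then have "I = {\<zero>}" using I by (force simp: image_iff)
    then show False using assms(2) by simp
  qed
  then have "x \<in> M" if "x \<in> carrier R" "g \<otimes> x = \<zero>" for x
    using that g(1) eq_zero_if_mult_Unit unfolding nonunits_def by blast
  then have K: "{x \<in> carrier R. g \<otimes> x = \<zero>} = {x \<in> M. g \<otimes> x = \<zero>}"
    using M.Icarr by blast
  have "additive_subgroup (carrier R) R"
    using oneideal ideal.axioms(1) by blast
  then have carrier: "card (carrier R) = card {x \<in> M. g \<otimes> x = \<zero>} * card I"
    using card_scale_image[OF finite_carrier _ g(1), of "carrier R"] I K by simp
  have M: "card M = card {x \<in> M. g \<otimes> x = \<zero>} * card (ideal_prod R I M)"
    using card_scale_image[OF finite_carrier M.additive_subgroup_axioms g(1)]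
      ideal_prod_cgenideal[OF g(1) nonunits_ideal] g(2) by simp
  have "0 < card {x \<in> M. g \<otimes> x = \<zero>}"
    using finite_M M.zero_closed g(1) by (auto simp: card_gt_0_iff intro!: exI[of _ \<zero>])
  moreover have "card {x \<in> M. g \<otimes> x = \<zero>} * card I
      = card {x \<in> M. g \<otimes> x = \<zero>} * (card (carrier (R Quot M)) * card (ideal_prod R I M))"
    using card_residue_field unfolding carrier M by (auto simp: mult.left_commute)
  ultimately show ?thesis by simp
qed

text \<open>Each step of the chain of powers of \<open>M\<close> divides the cardinality by the size
  of the residue field as long as the current power is nonzero. By minimality of \<open>r\<close>
  this happens for exactly \<open>r\<close> steps, after which one element is left.\<close>

lemma card_carrier_nilpotency:
  assumes "nilpotency_index R M r"
  shows "card (carrier R) = card (carrier (R Quot M)) ^ r"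
proof -
  let ?q = "card (carrier (R Quot M))"
  define p where "p n = M [^]\<^bsub>ideals_set R\<^esub> n" for n :: nat
  have p0: "p 0 = carrier R" and pS: "p (Suc n) = ideal_prod R (p n) M" for n
    by (simp_all add: p_def nat_pow_def ideals_set_def)
  have ideal: "ideal (p n) R" for n
    by (induction n) (auto simp: p0 pS oneideal intro!: ideal_prod_is_ideal nonunits_ideal)
  have "card (carrier R) = ?q ^ n * card (p n)" if "n \<le> r" for n
    using that
  proof (induction n)
    case 0
    show ?case by (simp add: p0)
  next
    case (Suc n)
    then have "p n \<noteq> {\<zero>}" using assms by (auto simp: nilpotency_index_def p_def)
    then have "card (p n) = ?q * card (p (Suc n))"
      using card_ideal_prod_M[OF ideal] by (simp add: pS)
    then show ?case using Suc by simp
  qed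
  from this[of r] show ?thesis using assms by (simp add: nilpotency_index_def p_def)
qed

section \<open>Points, coefficient vectors and solutions of linear equations\<close>

lemma finite_points: "finite (points R)"
  using finite_carrier by (simp add: points_def)

lemma card_points: "card (points R) = card (carrier R) ^ 3"
  by (simp add: points_def card_cartesian_product power3_eq_cube)

lemma finite_plane_coeffs: "finite (plane_coeffs R)"
  using finite_carrier by (simp add: plane_coeffs_def)

lemma M_subset: "M \<subseteq> carrier R"
  by (auto simp: nonunits_def)

lemma card_plane_coeffs: "real (card (plane_coeffs R)) = real (card (carrier R)) ^ 4 - real (card M) ^ 4"
proof -
  have "card (plane_coeffs R) = card (carrier R) ^ 4 - card M ^ 4"
    unfolding plane_coeffs_def using M_subset finite_M
    by (subst card_Diff_subset) (auto simp: card_cartesian_product power4_eq_xxxx)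
  moreover have "card M ^ 4 \<le> card (carrier R) ^ 4"
    by (intro power_mono card_mono finite_carrier M_subset) simp
  ultimately show ?thesis by simp
qed

lemma add_cancel_Unit:
  assumes "u \<in> Units R" "a \<in> carrier R" "a' \<in> carrier R" "s \<in> carrier R"
    "u \<otimes> a \<oplus> s = u \<otimes> a' \<oplus> s"
  shows "a = a'"
proof -
  have "u \<otimes> a = u \<otimes> a'" using assms Units_closed by simp
  then show ?thesis using assms by simp
qed

text \<open>A coordinate whose coefficient is a unit is determined by the other two, so forgetting
  it is injective on solutions. \<open>S\<close> is kept general because the bound is needed both
  for \<open>carrier R\<close> and for \<open>M\<close>.\<close>

lemma card_solutions_le:
  assumes "S \<subseteq> carrier R" "a \<in> carrier R" "b \<in> carrier R" "c \<in> carrier R"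
    and unit: "a \<in> Units R \<or> b \<in> Units R \<or> c \<in> Units R"
  shows "card {p \<in> S \<times> S \<times> S. satisfies R p (a, b, c, d)} \<le> card S ^ 2"
proof -
  let ?T = "{p \<in> S \<times> S \<times> S. satisfies R p (a, b, c, d)}"
  have fin: "finite (S \<times> S)" using assms(1) finite_carrier finite_subset by blast
  have bound: "card ?T \<le> card S ^ 2" if "inj_on f ?T" "f ` ?T \<subseteq> S \<times> S" for f :: "_ \<Rightarrow> 'a \<times> 'a"
    using card_inj_on_le[OF that fin] by (simp add: card_cartesian_product power2_eq_square)
  have S: "x \<in> carrier R" if "x \<in> S" for x using that assms(1) by blast
  consider "a \<in> Units R" | "b \<in> Units R" | "c \<in> Units R" using unit by blast
  then show ?thesis
  proof cases
    case 1
    have "inj_on (\<lambda>(x, y, z). (y, z)) ?T"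
    proof (rule inj_onI)
      fix p p' assume h: "p \<in> ?T" "p' \<in> ?T" "(case p of (x, y, z) \<Rightarrow> (y, z)) = (case p' of (x, y, z) \<Rightarrow> (y, z))"
      then obtain x y z x' where p: "p = (x, y, z)" "p' = (x', y, z)"
        by (cases p; cases p') auto
      have "x = x'"
        using h(1,2) assms(2-4) unfolding p
        by (intro add_cancel_Unit[OF 1, of x x' "b \<otimes> y \<oplus> c \<otimes> z"]) (auto simp: a_ac S)
      then show "p = p'" using p by simp
    qed
    then show ?thesis by (rule bound) auto
  next
    case 2
    have "inj_on (\<lambda>(x, y, z). (x, z)) ?T"
    proof (rule inj_onI)
      fix p p' assume h: "p \<in> ?T" "p' \<in> ?T" "(case p of (x, y, z) \<Rightarrow> (x, z)) = (case p' of (x, y, z) \<Rightarrow> (x, z))"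
      then obtain x y z y' where p: "p = (x, y, z)" "p' = (x, y', z)"
        by (cases p; cases p') auto
      have "y = y'"
        using h(1,2) assms(2-4) unfolding p
        by (intro add_cancel_Unit[OF 2, of y y' "a \<otimes> x \<oplus> c \<otimes> z"]) (auto simp: a_ac S)
      then show "p = p'" using p by simp
    qed
    then show ?thesis by (rule bound) auto
  next
    case 3
    have "inj_on (\<lambda>(x, y, z). (x, y)) ?T"
    proof (rule inj_onI)
      fix p p' assume h: "p \<in> ?T" "p' \<in> ?T" "(case p of (x, y, z) \<Rightarrow> (x, y)) = (case p' of (x, y, z) \<Rightarrow> (x, y))"
      then obtain x y z z' where p: "p = (x, y, z)" "p' = (x, y, z')"
        by (cases p; cases p') auto
      have "z = z'"
        using h(1,2) assms(2-4) unfolding p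
        by (intro add_cancel_Unit[OF 3, of z z' "a \<otimes> x \<oplus> b \<otimes> y"]) (auto simp: a_ac S)
      then show "p = p'" using p by simp
    qed
    then show ?thesis by (rule bound) auto
  qed
qed

lemma card_solutions_eq:
  assumes "a \<in> carrier R" "b \<in> carrier R" "c \<in> carrier R" "d \<in> carrier R"
    and unit: "a \<in> Units R \<or> b \<in> Units R \<or> c \<in> Units R"
  shows "card {p \<in> points R. satisfies R p (a, b, c, d)} = card (carrier R) ^ 2"
proof -
  let ?N = "\<lambda>d. card {p \<in> points R. satisfies R p (a, b, c, d)}"
  have le: "?N e \<le> card (carrier R) ^ 2" for e
    unfolding points_def using assms by (intro card_solutions_le) auto
  define f where "f = (\<lambda>(x, y, z). a \<otimes> x \<oplus> b \<otimes> y \<oplus> c \<otimes> z)"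
  have f: "f ` points R \<subseteq> carrier R" using assms by (auto simp: f_def points_def)
  have N: "?N e = card {p \<in> points R. f p = e}" for e
    by (rule arg_cong[of _ _ card]) (auto simp: f_def)
  \<comment> \<open>the \<open>card (carrier R)\<close> fibres have at most \<open>card (carrier R) ^ 2\<close> points each and fill \<open>points R\<close>, so all bounds are attained\<close>
  have "card (carrier R) ^ 3 = (\<Sum>e\<in>carrier R. ?N e)"
    using sum.group[OF finite_points finite_carrier f, of "\<lambda>_. 1::nat"] card_points by (simp add: N)
  also have "\<dots> = ?N d + (\<Sum>e\<in>carrier R - {d}. ?N e)"
    using assms(4) finite_carrier by (rule sum.remove[rotated])
  also have "\<dots> \<le> ?N d + (card (carrier R) - 1) * card (carrier R) ^ 2"
    using sum_bounded_above[of "carrier R - {d}" ?N "card (carrier R) ^ 2"] le assms(4) finite_carrier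
    by simp
  finally have "card (carrier R) ^ 3 \<le> ?N d + (card (carrier R) - 1) * card (carrier R) ^ 2" .
  \<comment> \<open>Positivity keeps the natural-number subtraction
    \<open>card (carrier R) - 1\<close> from truncating.\<close>
  moreover have "0 < card (carrier R)" using assms(4) finite_carrier by (auto simp: card_gt_0_iff)
  then have "card (carrier R) ^ 3 = card (carrier R) ^ 2 + (card (carrier R) - 1) * card (carrier R) ^ 2"
    by (cases "card (carrier R)") (simp_all add: power3_eq_cube power2_eq_square)
  ultimately show ?thesis using le[of d] by linarith
qed

text \<open>Take \<open>g\<close> generating the ideal of \<open>x\<close>, \<open>y\<close>,
  \<open>z\<close>, and divide by it. If all three quotients were in \<open>M\<close>, writing
  \<open>g\<close> as a combination of \<open>x\<close>, \<open>y\<close>, \<open>z\<close> would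
  give \<open>g = g \<otimes> w\<close> with \<open>w\<close> in \<open>M\<close>. Then
  \<open>\<one> \<ominus> w\<close> is a unit, which forces \<open>g\<close> to vanish, as in
  Nakayama's lemma.\<close>

lemma point_eq_scaled_primitive:
  assumes "x \<in> carrier R" "y \<in> carrier R" "z \<in> carrier R"
  obtains g x' y' z' where "g \<in> carrier R" "x' \<in> carrier R" "y' \<in> carrier R" "z' \<in> carrier R"
    "x = g \<otimes> x'" "y = g \<otimes> y'" "z = g \<otimes> z'"
    "x' \<in> Units R \<or> y' \<in> Units R \<or> z' \<in> Units R"
proof -
  let ?I = "set_add R (PIdl x) (set_add R (PIdl y) (PIdl z))"
  have "ideal ?I R" using assms by (intro add_ideals cgenideal_ideal)
  then obtain g where g: "g \<in> carrier R" "?I = PIdl g" by (rule ideal_eq_PIdl)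
  have zero: "\<zero> \<in> PIdl t" if "t \<in> carrier R" for t
    using that by (auto simp: cgenideal_def intro!: exI[of _ \<zero>])
  have mem: "a \<oplus> b \<in> set_add R A B" if "a \<in> A" "b \<in> B" for a b A B
    using that by (auto simp: set_add_def')
  have "x \<oplus> (\<zero> \<oplus> \<zero>) \<in> ?I" "\<zero> \<oplus> (y \<oplus> \<zero>) \<in> ?I" "\<zero> \<oplus> (\<zero> \<oplus> z) \<in> ?I"
    by (intro mem zero cgenideal_self zero_closed assms)+
  then have "x \<in> PIdl g" "y \<in> PIdl g" "z \<in> PIdl g" using assms g(2) by simp_all
  then obtain x' y' z' where s: "x' \<in> carrier R" "y' \<in> carrier R" "z' \<in> carrier R"
    "x = g \<otimes> x'" "y = g \<otimes> y'" "z = g \<otimes> z'"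
    using g(1) m_comm by (auto simp: cgenideal_def)
  show thesis
  proof (cases "x' \<in> Units R \<or> y' \<in> Units R \<or> z' \<in> Units R")
    case True
    then show thesis using that[of g x' y' z'] g s by blast
  next
    case False
    then have m: "x' \<in> M" "y' \<in> M" "z' \<in> M" using s by (simp_all add: nonunits_def)
    have "g \<in> ?I" using g cgenideal_self by simp
    then obtain a b c where abc: "a \<in> carrier R" "b \<in> carrier R" "c \<in> carrier R"
      and "g = a \<otimes> x \<oplus> (b \<otimes> y \<oplus> c \<otimes> z)"
      by (auto simp: set_add_def' cgenideal_def)
    then have "g = g \<otimes> (a \<otimes> x' \<oplus> (b \<otimes> y' \<oplus> c \<otimes> z'))"
      using s g(1) by (simp add: r_distr m_lcomm)
    moreover define w where "w = a \<otimes> x' \<oplus> (b \<otimes> y' \<oplus> c \<otimes> z')"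
    ultimately have gw: "g = g \<otimes> w" by simp
    have w: "w \<in> M" unfolding w_def using m abc M.I_l_closed by simp
    have wc: "w \<in> carrier R" using w M.Icarr by blast
    have "\<one> \<ominus> w \<in> Units R"
    proof (rule ccontr)
      assume "\<one> \<ominus> w \<notin> Units R"
      then have "\<one> \<ominus> w \<in> M" using wc by (simp add: nonunits_def)
      then have "(\<one> \<ominus> w) \<oplus> w \<in> M" using w by simp
      then have "\<one> \<in> M" using wc by (simp add: minus_eq a_assoc l_neg)
      then show False by (simp add: nonunits_def)
    qed
    moreover have "g \<otimes> (\<one> \<ominus> w) = \<zero>"
      using gw g(1) wc by (simp add: minus_eq r_distr r_minus r_neg)
    ultimately have "g = \<zero>"
      using g(1) eq_zero_if_mult_Unit by blast
    \<comment> \<open>The vector is zero here. The quotients found above are nonunits, so they are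
      replaced by (1, 1, 1), scaled by \<zero>.\<close>
    then have "x = \<zero> \<otimes> \<one>" "y = \<zero> \<otimes> \<one>" "z = \<zero> \<otimes> \<one>" using s by simp_all
    then show thesis using that[of \<zero> \<one> \<one> \<one>] by simp
  qed
qed

section \<open>Coefficient vectors through one and through two points\<close>

text \<open>The last coefficient is a function of the first three. If these lie in the ideal
  \<open>M\<close>, so does the last one, and the vector is excluded; hence the condition of having
  a unit entry falls on \<open>a\<close>, \<open>b\<close>, \<open>c\<close> alone.\<close>

lemma planes_through_point:
  assumes "x \<in> carrier R" "y \<in> carrier R" "z \<in> carrier R"
  shows "{v \<in> plane_coeffs R. satisfies R (x, y, z) v} =
    (\<lambda>(a, b, c). (a, b, c, a \<otimes> x \<oplus> b \<otimes> y \<oplus> c \<otimes> z)) ` (points R - M \<times> M \<times> M)" (is "?L = ?f ` ?D")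
proof
  show "?L \<subseteq> ?f ` ?D"
  proof
    fix v assume v: "v \<in> ?L"
    obtain a b c d where abcd: "v = (a, b, c, d)" by (metis prod.exhaust)
    have "(a, b, c) \<notin> M \<times> M \<times> M"
    proof
      assume "(a, b, c) \<in> M \<times> M \<times> M"
      then have "a \<otimes> x \<oplus> b \<otimes> y \<oplus> c \<otimes> z \<in> M" using assms M.I_r_closed by simp
      then show False using v abcd \<open>(a, b, c) \<in> M \<times> M \<times> M\<close> by (auto simp: plane_coeffs_def)
    qed
    then have "(a, b, c) \<in> ?D" using v abcd by (auto simp: plane_coeffs_def points_def)
    moreover have "v = ?f (a, b, c)" using v abcd by simp
    ultimately show "v \<in> ?f ` ?D" by blast
  qed
  show "?f ` ?D \<subseteq> ?L" using assms by (auto simp: plane_coeffs_def points_def)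
qed

lemma card_planes_through_point:
  assumes "p \<in> points R"
  shows "real (card {v \<in> plane_coeffs R. satisfies R p v}) = real (card (carrier R)) ^ 3 - real (card M) ^ 3"
proof -
  obtain x y z where p: "p = (x, y, z)" "x \<in> carrier R" "y \<in> carrier R" "z \<in> carrier R"
    using assms by (auto simp: points_def)
  have "card {v \<in> plane_coeffs R. satisfies R p v} = card (points R - M \<times> M \<times> M)"
    unfolding p(1) planes_through_point[OF p(2-4)] by (rule card_image) (auto simp: inj_on_def)
  also have "\<dots> = card (carrier R) ^ 3 - card M ^ 3"
  proof (subst card_Diff_subset)
    show "M \<times> M \<times> M \<subseteq> points R" using M_subset by (auto simp: points_def)
  qed (simp_all add: finite_M card_points card_cartesian_product power3_eq_cube)
  finally have "card {v \<in> plane_coeffs R. satisfies R p v} = card (carrier R) ^ 3 - card M ^ 3" .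
  moreover have "card M ^ 3 \<le> card (carrier R) ^ 3"
    by (intro power_mono card_mono finite_carrier M_subset) simp
  ultimately show ?thesis by simp
qed

text \<open>Write the difference of the points as \<open>g\<close> times a vector (s, t, u) with a
  unit entry. A vector through \<open>p\<close> also passes through \<open>p'\<close> if (a, b, c)
  is orthogonal to (s, t, u). This has \<open>card (carrier R) ^ 2\<close> solutions, of which at
  most \<open>card M ^ 2\<close> lie in \<open>M \<times> M \<times> M\<close> and must be
  discarded. Only an inequality results, since it would suffice that \<open>g\<close> annihilates
  the inner product. Equal points are included.\<close>

lemma card_planes_through_two_points_ge:
  assumes "p \<in> points R" "p' \<in> points R"
  shows "real (card (carrier R)) ^ 2 - real (card M) ^ 2
    \<le> real (card {v \<in> plane_coeffs R. satisfies R p v \<and> satisfies R p' v})"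
proof -
  obtain x y z where p: "p = (x, y, z)" "x \<in> carrier R" "y \<in> carrier R" "z \<in> carrier R"
    using assms by (auto simp: points_def)
  obtain x' y' z' where p': "p' = (x', y', z')" "x' \<in> carrier R" "y' \<in> carrier R" "z' \<in> carrier R"
    using assms by (auto simp: points_def)
  have "x' \<ominus> x \<in> carrier R" "y' \<ominus> y \<in> carrier R" "z' \<ominus> z \<in> carrier R"
    using p p' by simp_all
  then obtain g s t u where g: "g \<in> carrier R" "s \<in> carrier R" "t \<in> carrier R" "u \<in> carrier R"
    and gs: "x' \<ominus> x = g \<otimes> s" "y' \<ominus> y = g \<otimes> t" "z' \<ominus> z = g \<otimes> u"
    and unit: "s \<in> Units R \<or> t \<in> Units R \<or> u \<in> Units R"
    by (rule point_eq_scaled_primitive)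
  have sub: "b = a \<oplus> (b \<ominus> a)" if "a \<in> carrier R" "b \<in> carrier R" for a b
    using that by (simp add: minus_eq a_lcomm[of a b "\<ominus> a"] r_neg)
  have shift: "x' = x \<oplus> g \<otimes> s" "y' = y \<oplus> g \<otimes> t" "z' = z \<oplus> g \<otimes> u"
    unfolding gs[symmetric] using p p' by (intro sub; simp)+
  let ?A = "{w \<in> points R. satisfies R w (s, t, u, \<zero>)}"
  let ?B = "{w \<in> M \<times> M \<times> M. satisfies R w (s, t, u, \<zero>)}"
  let ?f = "\<lambda>(a, b, c). (a, b, c, a \<otimes> x \<oplus> b \<otimes> y \<oplus> c \<otimes> z)"
  let ?T = "{v \<in> plane_coeffs R. satisfies R p v \<and> satisfies R p' v}"
  have A: "card ?A = card (carrier R) ^ 2" using g unit by (intro card_solutions_eq) auto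
  have B: "card ?B \<le> card M ^ 2" using g unit M_subset by (intro card_solutions_le) auto
  have "?f ` (?A - ?B) \<subseteq> ?T"
  proof
    fix v assume "v \<in> ?f ` (?A - ?B)"
    then obtain w where w: "w \<in> ?A - ?B" "v = ?f w" by (rule imageE)
    obtain a b c where "w = (a, b, c)" by (cases w)
    with w have v: "v = ?f (a, b, c)" and abc: "(a, b, c) \<in> ?A - ?B" by (simp_all only:)
    then have car: "a \<in> carrier R" "b \<in> carrier R" "c \<in> carrier R"
      and eq: "s \<otimes> a \<oplus> t \<otimes> b \<oplus> u \<otimes> c = \<zero>" and D: "(a, b, c) \<in> points R - M \<times> M \<times> M"
      by (auto simp: points_def)
    have "v \<in> {v \<in> plane_coeffs R. satisfies R p v}"
      unfolding p(1) planes_through_point[OF p(2-4)] v using D by (rule imageI)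
    moreover have "a \<otimes> x' \<oplus> b \<otimes> y' \<oplus> c \<otimes> z'
      = (a \<otimes> x \<oplus> b \<otimes> y \<oplus> c \<otimes> z) \<oplus> g \<otimes> (s \<otimes> a \<oplus> t \<otimes> b \<oplus> u \<otimes> c)"
      unfolding shift using car g p by (simp add: r_distr m_ac a_ac)
    then have "satisfies R p' v" using car p g by (simp add: p'(1) v eq)
    ultimately show "v \<in> ?T" by simp
  qed
  moreover have "inj_on ?f (?A - ?B)"
    by (rule inj_onI) (simp add: split_beta prod_eq_iff)
  moreover have "finite ?T" using finite_plane_coeffs by simp
  ultimately have "card (?A - ?B) \<le> card ?T" by (intro card_inj_on_le)
  moreover have "card ?A \<le> card (?A - ?B) + card ?B"
    using diff_card_le_card_Diff[of ?B ?A] finite_M by simp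
  ultimately have "card (carrier R) ^ 2 \<le> card ?T + card M ^ 2" using A B by linarith
  then have "real (card (carrier R) ^ 2) \<le> real (card ?T + card M ^ 2)" by (rule of_nat_mono)
  then show ?thesis by simp
qed

text \<open>Double counting of the pairs of a point \<open>p'\<close> and a vector incident to both
  \<open>p\<close> and \<open>p'\<close>: every vector through \<open>p\<close> has a unit among its
  first three entries, hence \<open>card (carrier R) ^ 2\<close> points.\<close>

lemma sum_planes_through_two_points:
  assumes "p \<in> points R"
  shows "(\<Sum>p'\<in>points R. real (card {v \<in> plane_coeffs R. satisfies R p v \<and> satisfies R p' v}))
    = (real (card (carrier R)) ^ 3 - real (card M) ^ 3) * real (card (carrier R)) ^ 2"
proof -
  obtain x y z where p: "p = (x, y, z)" "x \<in> carrier R" "y \<in> carrier R" "z \<in> carrier R"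
    using assms by (auto simp: points_def)
  define S where "S = {v \<in> plane_coeffs R. satisfies R p v}"
  have fin: "finite S" using finite_plane_coeffs by (simp add: S_def)
  have "{v \<in> plane_coeffs R. satisfies R p v \<and> satisfies R p' v} = {v \<in> S. satisfies R p' v}" for p'
    by (auto simp: S_def)
  then have "(\<Sum>p'\<in>points R. real (card {v \<in> plane_coeffs R. satisfies R p v \<and> satisfies R p' v}))
    = (\<Sum>p'\<in>points R. \<Sum>v\<in>S. of_bool (satisfies R p' v))"
    by (simp only: real_card_filter[OF fin])
  also have "\<dots> = (\<Sum>v\<in>S. \<Sum>p'\<in>points R. of_bool (satisfies R p' v))"
    by (rule sum.swap)
  also have "\<dots> = (\<Sum>v\<in>S. real (card (carrier R)) ^ 2)"
  proof (intro sum.cong refl)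
    fix v assume "v \<in> S"
    then obtain w where w: "w \<in> points R - M \<times> M \<times> M"
      "v = (\<lambda>(a, b, c). (a, b, c, a \<otimes> x \<oplus> b \<otimes> y \<oplus> c \<otimes> z)) w"
      unfolding S_def p(1) planes_through_point[OF p(2-4)] by (rule imageE)
    obtain a b c where "w = (a, b, c)" by (cases w)
    with w have v: "v = (a, b, c, a \<otimes> x \<oplus> b \<otimes> y \<oplus> c \<otimes> z)"
      and abc: "(a, b, c) \<in> points R - M \<times> M \<times> M" by simp_all
    from abc have "a \<in> carrier R" "b \<in> carrier R" "c \<in> carrier R"
      "a \<in> Units R \<or> b \<in> Units R \<or> c \<in> Units R"
      by (auto simp: points_def nonunits_def)
    then have "card {p' \<in> points R. satisfies R p' v} = card (carrier R) ^ 2"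
      unfolding v using p by (intro card_solutions_eq) auto
    then show "(\<Sum>p'\<in>points R. of_bool (satisfies R p' v)) = real (card (carrier R)) ^ 2"
      by (simp only: real_card_filter[OF finite_points, symmetric] of_nat_power)
  qed
  also have "\<dots> = (real (card (carrier R)) ^ 3 - real (card M) ^ 3) * real (card (carrier R)) ^ 2"
    using card_planes_through_point[OF assms] by (simp add: S_def)
  finally show ?thesis .
qed

section \<open>Variance over coefficient vectors\<close>

text \<open>The proportion of all coefficient vectors that pass through a given point.\<close>

definition density :: real where
  "density = (real (card (carrier R)) ^ 3 - real (card M) ^ 3) / (real (card (carrier R)) ^ 4 - real (card M) ^ 4)"

lemma sum_deviation_plane_coeffs_le:
  assumes "Q \<subseteq> points R"
  shows "(\<Sum>v\<in>plane_coeffs R. (real (card {p \<in> Q. satisfies R p v}) - density * real (card Q))\<^sup>2)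
    \<le> real (card (Units R)) * (real (card Q) * (real (card M) * real (card (carrier R)))\<^sup>2)"
proof -
  define n where "n = real (card (carrier R))"
  define m where "m = real (card M)"
  define k where "k = n ^ 3 - m ^ 3"
  define a where "a = n ^ 2 - m ^ 2"
  define N where "N p p' = real (card {v \<in> plane_coeffs R. satisfies R p v \<and> satisfies R p' v})" for p p'
  have fQ: "finite Q" using assms finite_points finite_subset by blast
  have m0: "0 < m" using card_M_pos by (simp add: m_def)
  have U: "n - m = real (card (Units R))" by (simp add: n_def m_def card_carrier_eq)
  have mn: "m < n" using U card_Units_pos by simp
  have V: "real (card (plane_coeffs R)) = n ^ 4 - m ^ 4" by (simp add: n_def m_def card_plane_coeffs)
  have V0: "0 < n ^ 4 - m ^ 4" using power_strict_mono[OF mn, of 4] m0 by simp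
  have row: "(\<Sum>p'\<in>Q. N p p') \<le> a * real (card Q) + m\<^sup>2 * n\<^sup>2 * (n - m)" if "p \<in> Q" for p
  proof -
    have p: "p \<in> points R" using that assms by blast
    \<comment> \<open>Each summand is nonnegative, so the sum may be extended from \<open>Q\<close>
      to all points, where its value is known exactly.\<close>
    have "(\<Sum>p'\<in>Q. N p p' - a) \<le> (\<Sum>p'\<in>points R. N p p' - a)"
      using card_planes_through_two_points_ge[OF p] assms finite_points
      by (intro sum_mono2) (auto simp: N_def a_def n_def m_def)
    also have "\<dots> = k * n\<^sup>2 - a * n ^ 3"
      using sum_planes_through_two_points[OF p] card_points
      by (simp add: sum_subtractf N_def k_def n_def m_def)
    also have "\<dots> = m\<^sup>2 * n\<^sup>2 * (n - m)"
      by (simp add: k_def a_def algebra_simps power2_eq_square power3_eq_cube)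
    finally show ?thesis by (simp add: sum_subtractf algebra_simps)
  qed
  \<comment> \<open>The defect is a perfect square. This fixes the sign of
    \<open>a - k\<^sup>2 / (n ^ 4 - m ^ 4)\<close>, the coefficient of the squared cardinality of
    \<open>Q\<close> in the final estimate, so that only the term linear in \<open>card Q\<close>
    survives.\<close>
  have "a * (n ^ 4 - m ^ 4) = k\<^sup>2 - (n * m * (n - m))\<^sup>2"
    by (simp add: a_def k_def algebra_simps power2_eq_square power3_eq_cube power4_eq_xxxx)
  then have "a * (n ^ 4 - m ^ 4) \<le> k\<^sup>2" by simp
  then have ak: "a \<le> k\<^sup>2 / (n ^ 4 - m ^ 4)" using V0 by (simp add: field_simps)
  have "(\<Sum>v\<in>plane_coeffs R. (real (card {p \<in> Q. satisfies R p v}) - density * real (card Q))\<^sup>2)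
    = (\<Sum>p\<in>Q. \<Sum>p'\<in>Q. N p p') - k\<^sup>2 / (n ^ 4 - m ^ 4) * (real (card Q))\<^sup>2"
    using sum_degree_deviation[OF fQ finite_plane_coeffs, of "satisfies R" k]
      card_planes_through_point assms
    unfolding density_def V N_def k_def n_def m_def by blast
  also have "(\<Sum>p\<in>Q. \<Sum>p'\<in>Q. N p p') \<le> (\<Sum>p\<in>Q. a * real (card Q) + m\<^sup>2 * n\<^sup>2 * (n - m))"
    using row by (rule sum_mono)
  also have "\<dots> = a * (real (card Q))\<^sup>2 + (n - m) * (real (card Q) * (m * n)\<^sup>2)"
    by (simp add: algebra_simps power2_eq_square)
  finally show ?thesis
    using mult_right_mono[OF ak, of "(real (card Q))\<^sup>2"]
    unfolding U[symmetric] m_def[symmetric] n_def[symmetric] by simp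
qed

section \<open>From coefficient vectors to planes\<close>

lemma equiv_plane_coeffs: "equiv (plane_coeffs R) (unit_proportional R)"
  using equiv_unit_proportional is_cring by blast

text \<open>A plane is an orbit of the unit group under scaling. The action is free, because a unit
  entry of the vector can be cancelled.\<close>

lemma card_plane:
  assumes "\<pi> \<in> planes R"
  shows "card \<pi> = card (Units R)"
proof -
  obtain a b c d where v: "(a, b, c, d) \<in> plane_coeffs R"
    and \<pi>: "\<pi> = unit_proportional R `` {(a, b, c, d)}"
    using assms unfolding planes_def by (auto elim!: quotientE)
  let ?f = "\<lambda>u. (u \<otimes> a, u \<otimes> b, u \<otimes> c, u \<otimes> d)"
  have car: "a \<in> carrier R" "b \<in> carrier R" "c \<in> carrier R" "d \<in> carrier R"
    and unit: "a \<in> Units R \<or> b \<in> Units R \<or> c \<in> Units R \<or> d \<in> Units R"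
    using v by (auto simp: plane_coeffs_def nonunits_def)
  have cancel: "u = u'" if "t \<in> Units R" "u \<in> Units R" "u' \<in> Units R" "u \<otimes> t = u' \<otimes> t" for t u u'
    using that Units_closed m_comm Units_l_cancel by metis
  have "inj_on ?f (Units R)"
    using unit by (intro inj_onI) (auto dest: cancel)
  moreover have "?f u \<in> plane_coeffs R" if u: "u \<in> Units R" for u
  proof -
    have "u \<otimes> t \<in> Units R" if "t \<in> Units R" for t using that u by simp
    then show ?thesis using car unit u Units_closed by (auto simp: plane_coeffs_def nonunits_def)
  qed
  then have "\<pi> = ?f ` Units R"
    unfolding \<pi> using v by (auto simp: unit_proportional_def)
  ultimately show ?thesis by (simp add: card_image)
qed

text \<open>Carries the variance bound over to planes: the classes partition the coefficient vectors
  and all have the size of the unit group.\<close>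

lemma sum_plane_coeffs:
  fixes f :: "_ \<Rightarrow> real"
  assumes "\<And>\<pi> v. \<pi> \<in> planes R \<Longrightarrow> v \<in> \<pi> \<Longrightarrow> f v = h \<pi>"
  shows "(\<Sum>v\<in>plane_coeffs R. f v) = real (card (Units R)) * (\<Sum>\<pi>\<in>planes R. h \<pi>)"
proof -
  have U: "\<Union>(planes R) = plane_coeffs R"
    unfolding planes_def by (rule Union_quotient[OF equiv_plane_coeffs])
  have "(\<Sum>v\<in>\<Union>(planes R). f v) = (\<Sum>\<pi>\<in>planes R. \<Sum>v\<in>\<pi>. f v)"
  proof (subst sum.Union_disjoint)
    show "\<forall>A\<in>planes R. finite A"
      using U finite_plane_coeffs by (metis Union_upper finite_subset)
    show "\<forall>A\<in>planes R. \<forall>B\<in>planes R. A \<noteq> B \<longrightarrow> A \<inter> B = {}"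
      using quotient_disj[OF equiv_plane_coeffs] unfolding planes_def by blast
  qed simp
  also have "\<dots> = (\<Sum>\<pi>\<in>planes R. real (card (Units R)) * h \<pi>)"
    using assms by (intro sum.cong refl) (simp add: card_plane)
  finally show ?thesis by (simp add: U sum_distrib_left)
qed

lemma finite_planes: "finite (planes R)"
  unfolding planes_def
  by (rule finite_quotient[OF finite_plane_coeffs]) (auto simp: unit_proportional_def)

lemma incidences_deviation:
  assumes "Q \<subseteq> points R" "P \<subseteq> planes R"
  shows "\<bar>real (card (incidences R Q P)) - density * real (card Q) * real (card P)\<bar>
    \<le> real (card M) * real (card (carrier R)) * sqrt (real (card Q)) * sqrt (real (card P))"
proof -
  define F where "F \<pi> = real (card {p \<in> Q. incident R p \<pi>}) - density * real (card Q)" for \<pi>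
  define B where "B = real (card M) * real (card (carrier R))"
  have fQ: "finite Q" and fP: "finite P"
    using assms finite_points finite_planes finite_subset by blast+
  have "{p \<in> Q. incident R p \<pi>} = {p \<in> Q. satisfies R p v}" if "\<pi> \<in> planes R" "v \<in> \<pi>" for \<pi> v
    using incident_iff_satisfies[OF is_cring that] assms(1) by blast
  then have "(\<Sum>v\<in>plane_coeffs R. (real (card {p \<in> Q. satisfies R p v}) - density * real (card Q))\<^sup>2)
    = real (card (Units R)) * (\<Sum>\<pi>\<in>planes R. (F \<pi>)\<^sup>2)"
    by (intro sum_plane_coeffs) (simp add: F_def)
  then have "real (card (Units R)) * (\<Sum>\<pi>\<in>planes R. (F \<pi>)\<^sup>2)
      \<le> real (card (Units R)) * (real (card Q) * B\<^sup>2)"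
    using sum_deviation_plane_coeffs_le[OF assms(1)] by (simp add: B_def)
  then have "(\<Sum>\<pi>\<in>planes R. (F \<pi>)\<^sup>2) \<le> real (card Q) * B\<^sup>2"
    using card_Units_pos by simp
  \<comment> \<open>Squares are nonnegative, so the bound over all planes holds for any subset
    \<open>P\<close>.\<close>
  moreover have "(\<Sum>\<pi>\<in>P. (F \<pi>)\<^sup>2) \<le> (\<Sum>\<pi>\<in>planes R. (F \<pi>)\<^sup>2)"
    using assms(2) finite_planes by (intro sum_mono2) auto
  ultimately have F2: "(\<Sum>\<pi>\<in>P. (F \<pi>)\<^sup>2) \<le> real (card Q) * B\<^sup>2" by linarith
  have "incidences R Q P = (\<lambda>(\<pi>, p). (p, \<pi>)) ` (SIGMA \<pi>:P. {p \<in> Q. incident R p \<pi>})"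
    by (auto simp: incidences_def)
  then have "card (incidences R Q P) = card (SIGMA \<pi>:P. {p \<in> Q. incident R p \<pi>})"
    by (simp add: card_image inj_on_def split_beta prod_eq_iff)
  then have "real (card (incidences R Q P)) - density * real (card Q) * real (card P) = (\<Sum>\<pi>\<in>P. F \<pi>)"
    using fP fQ by (simp add: F_def sum_subtractf)
  \<comment> \<open>The constant factor 1 prepares Cauchy-Schwarz; its norm over \<open>P\<close>
    supplies the square root of \<open>card P\<close>.\<close>
  then have "\<bar>real (card (incidences R Q P)) - density * real (card Q) * real (card P)\<bar>
      \<le> (\<Sum>\<pi>\<in>P. \<bar>F \<pi>\<bar> * \<bar>1\<bar>)"
    by simp
  also have "\<dots> \<le> L2_set F P * L2_set (\<lambda>_. 1) P"
    by (rule L2_set_mult_ineq)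
  also have "\<dots> \<le> sqrt (real (card Q) * B\<^sup>2) * sqrt (real (card P))"
    using F2 by (intro mult_mono) (auto simp: L2_set_def sum_nonneg)
  also have "\<dots> = B * sqrt (real (card Q)) * sqrt (real (card P))"
    by (simp add: real_sqrt_mult B_def)
  finally show ?thesis unfolding B_def .
qed

end

section \<open>Translation to a ring with parameters q and r\<close>

lemma finite_principal_local_ringI:
  assumes "finite_valuation_ring R"
  shows "finite_principal_local_ring R" "max_ideal R = nonunits R"
proof -
  interpret cring R using assms by (simp add: finite_valuation_ring_def)
  have fin: "finite (carrier R)" and ex: "\<exists>!M. maximalideal M R"
    and pr: "\<And>I. ideal I R \<Longrightarrow> principalideal I R"
    using assms by (simp_all add: finite_valuation_ring_def)
  have max: "maximalideal (max_ideal R) R"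
    unfolding max_ideal_def using ex by (rule theI')
  then show eq: "max_ideal R = nonunits R"
    by (rule unique_maximalideal_eq_nonunits[OF fin ex])
  show "finite_principal_local_ring R"
  proof (intro finite_principal_local_ring.intro finite_principal_local_ring_axioms.intro)
    show "ideal (nonunits R) R" using maximalideal.axioms(1)[OF max] by (simp only: eq)
  qed (fact is_cring fin pr)+
qed

theorem theorem2p3:
  fixes R :: "('a, 'm) ring_scheme"
    and q r :: nat
    and Q :: "('a \<times> 'a \<times> 'a) set"
    and P :: "('a \<times> 'a \<times> 'a \<times> 'a) set set"
  assumes "finite_valuation_ring_of_order R q r"
    and "Q \<subseteq> points R"
    and "P \<subseteq> planes R"
  shows "\<bar>real (card (incidences R Q P)) -
            1 / real q ^ (r - 1) *
            ((real q ^ 2 + real q + 1) / (real q ^ 3 + real q ^ 2 + real q + 1)) *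
            real (card Q) * real (card P)\<bar>
          \<le> real q ^ (2 * r - 1) * sqrt (real (card Q)) * sqrt (real (card P)) \<and>
         real (card (incidences R Q P))
          \<le> 1 / real q ^ r * real (card Q) * real (card P) +
            real q ^ (2 * r - 1) * sqrt (real (card Q)) * sqrt (real (card P))"
proof -
  have fvr: "finite_valuation_ring R" and q: "card (carrier (R Quot max_ideal R)) = q"
    and r: "r \<ge> 1" and nil: "nilpotency_index R (max_ideal R) r"
    using assms(1) by (simp_all add: finite_valuation_ring_of_order_def)
  interpret finite_principal_local_ring R by (rule finite_principal_local_ringI[OF fvr])
  note max = finite_principal_local_ringI(2)[OF fvr]
  \<comment> \<open>This will be the cardinality of the maximal ideal; \<open>r \<ge> 1\<close>
    makes the exponent meaningful.\<close>
  define m where "m = real q ^ (r - 1)"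
  have qr: "real q ^ r = real q * m" using r by (cases r) (simp_all add: m_def)
  have n: "real (card (carrier R)) = real q * m"
    using card_carrier_nilpotency[of r] nil q by (simp add: max qr[symmetric])
  have qM: "q * card M = card (carrier R)" using card_residue_field q by (simp add: max)
  have "card M < card (carrier R)" using card_carrier_eq card_Units_pos by simp
  \<comment> \<open>Otherwise \<open>q * card M\<close> could not exceed
    \<open>card M\<close>.\<close>
  then have q1: "1 < q" using qM by (metis less_irrefl less_one linorder_neqE_nat mult_1 mult_is_0 not_less0)
  then have M: "real (card M) = m" using arg_cong[OF qM, of real] n by simp
  have m0: "0 < m" using q1 by (simp add: m_def)
  define s where "s = real q ^ 2 + real q + 1"
  define t where "t = real q ^ 3 + real q ^ 2 + real q + 1"
  have t0: "0 < t" using q1 by (simp add: t_def add_pos_pos)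
  \<comment> \<open>With n = qm, the differences n^3 - m^3 and n^4 - m^4 share the factor (q - 1)
    m^3, which is nonzero.\<close>
  have "density = ((real q - 1) * m ^ 3 * s) / ((real q - 1) * m ^ 3 * (m * t))"
    unfolding density_def n M
    by (rule arg_cong2[of _ _ _ _ "(/)"])
      (simp_all add: s_def t_def algebra_simps power2_eq_square power3_eq_cube power4_eq_xxxx)
  also have "\<dots> = 1 / m * (s / t)" using q1 m0 by simp
  finally have dens: "density = 1 / m * (s / t)" .
  have "real q ^ (2 * r - 1) = m * (real q * m)"
    using r by (cases r) (simp_all add: m_def power_add[symmetric] mult_2)
  then have main: "\<bar>real (card (incidences R Q P)) - 1 / m * (s / t) * real (card Q) * real (card P)\<bar>
      \<le> real q ^ (2 * r - 1) * sqrt (real (card Q)) * sqrt (real (card P))"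
    using incidences_deviation[OF assms(2,3)] by (simp only: dens n M)
  \<comment> \<open>In fact \<open>t = real q * s + 1\<close>, so the density is at most
    \<open>1 / real q ^ r\<close>; this yields the second inequality.\<close>
  have "real q * s \<le> t" by (simp add: s_def t_def algebra_simps power2_eq_square power3_eq_cube)
  then have "1 / m * (s / t) \<le> 1 / real q ^ r"
    unfolding qr using q1 m0 t0 by (simp add: field_simps)
  then have "1 / m * (s / t) * real (card Q) * real (card P) \<le> 1 / real q ^ r * real (card Q) * real (card P)"
    by (intro mult_right_mono) simp_all
  then show ?thesis using main unfolding s_def t_def m_def by linarith
qed

end
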